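(* Let $\pi:X\to B$ be a function between metric spaces, let $\mathcal{U}=\{U_j\}_{j\in J}$ be an open cover of $B$, and let $\alpha>0$. Suppose $\Omega$ witnesses that $\mathfrak{F}\in\Gamma_\alpha(\pi,\mathcal{U})$. Then $\Omega\in\check Z^1_{3\sqrt2\,\alpha}\big(\mathcal{U};\underline{O(2)}\big)$.
   Context: $U_{jk}=U_j\cap U_k$, $U_{jkl}=U_j\cap U_k\cap U_l$; $(jk)\in\mathcal{N}(\mathcal{U})$ (resp. $(jkl)\in\mathcal{N}(\mathcal{U})$) means $U_{jk}\ne\emptyset$ (resp. $U_{jkl}\neq\emptyset$), indices not necessarily distinct. $\mathbb{S}^1\subset\mathbb{C}\cong\mathbb{R}^2$, with $O(2)$ acting linearly; $|\cdot|$ is the Euclidean norm; $\|\cdot\|_F$ is the Frobenius norm. For $\varepsilon>0$, $0\le\delta<1$, $\Gamma_{\varepsilon,\delta}(\pi,\mathcal{U})$ is the set of families $\mathfrak{F}=\{f_j:\pi^{-1}(U_j)\to\mathbb{S}^1\}_{j\in J}$ (arbitrary functions) such that: (1) there is a cochain $\Omega=\{\Omega_{jk}\in O(2)\}_{(jk)\in\mathcal{N}(\mathcal{U})}$ with $|f_j(x)-\Omega_{jk}f_k(x)|<\varepsilon$ for all $(jk)\in\mathcal{N}(\mathcal{U})$ and $x\in\pi^{-1}(U_{jk})$; (2) the Hausdorff distance in $(\mathbb{C},|\cdot|)$ satisfies $d_H(f_l(\pi^{-1}(U_{jkl})),\mathbb{S}^1)<\delta$ for every $(jkl)\in\mathcal{N}(\mathcal{U})$.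 Any $\Omega$ as in (1) is called a witness that $\mathfrak{F}\in\Gamma_{\varepsilon,\delta}(\pi,\mathcal{U})$. For $\alpha>0$, $\Gamma_\alpha(\pi,\mathcal{U})=\bigcup_{\varepsilon/(1-\delta)<\alpha}\Gamma_{\varepsilon,\delta}(\pi,\mathcal{U})$, and $\Omega$ witnesses that $\mathfrak{F}\in\Gamma_\alpha(\pi,\mathcal{U})$ if it witnesses $\mathfrak{F}\in\Gamma_{\varepsilon,\delta}(\pi,\mathcal{U})$ for some $\varepsilon,\delta$ with $\varepsilon/(1-\delta)<\alpha$. For $\eta>0$, $\check Z^1_\eta(\mathcal{U};\underline{O(2)})$ is the set of discrete $\eta$-approximate cocycles: families of locally constant (here constant) maps $\Omega_{jk}:U_{jk}\to O(2)$ with $\sup_{(jkl)\in\mathcal{N}(\mathcal{U})}\sup_{b\in U_{jkl}}\|\Omega_{jk}(b)\Omega_{kl}(b)-\Omega_{jl}(b)\|_F<\eta$. *)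

theory Defs
  imports "HOL-Analysis.Analysis"
begin

section \<open>The group O(2) and its linear action on the complex plane\<close>

definition O2 :: "(real^2^2) set" where
  "O2 = {A. orthogonal_matrix A}"

text \<open>The identification of the complex plane with \<open>\<real>\<^sup>2\<close>.\<close>

definition vec_of_complex :: "complex \<Rightarrow> real^2" where
  "vec_of_complex z = vector [Re z, Im z]"

definition complex_of_vec :: "real^2 \<Rightarrow> complex" where
  "complex_of_vec v = Complex (v $ 1) (v $ 2)"

definition act :: "real^2^2 \<Rightarrow> complex \<Rightarrow> complex"  (infixr \<open>\<bullet>\<^sub>O\<close> 75) where
  "A \<bullet>\<^sub>O z = complex_of_vec (A *v vec_of_complex z)"

abbreviation S1 :: "complex set" where
  "S1 \<equiv> sphere 0 1"

text \<open>The Frobenius norm is the library norm on \<^typ>\<open>real^2^2\<close>: both levels of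
  \<^typ>\<open>real^2^2\<close> carry the Euclidean norm.\<close>

lemma norm_eq_frobenius:
  fixes A :: "real^'n^'m"
  shows "norm A = sqrt (\<Sum>i\<in>UNIV. \<Sum>j\<in>UNIV. (A $ i $ j)\<^sup>2)"
  by (simp add: norm_vec_def L2_set_def sum_nonneg)

section \<open>Hausdorff distance\<close>

text \<open>Valued in \<^typ>\<open>ennreal\<close>, so that an infimum over the empty set is \<open>\<infinity>\<close>. In particular
  the distance from the empty set to a nonempty set is \<open>\<infinity>\<close>; with the real-valued
  \<^const>\<open>infdist\<close> it would be 0.\<close>

definition hausdorff_dist :: "'a::metric_space set \<Rightarrow> 'a set \<Rightarrow> ennreal" where
  "hausdorff_dist A B =
     max (SUP a\<in>A. INF b\<in>B. ennreal (dist a b)) (SUP b\<in>B. INF a\<in>A. ennreal (dist a b))"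

section \<open>Open covers and their nerves\<close>

definition open_cover :: "'b metric \<Rightarrow> 'j set \<Rightarrow> ('j \<Rightarrow> 'b set) \<Rightarrow> bool" where
  "open_cover B J U \<longleftrightarrow>
     (\<forall>j\<in>J. openin (mtopology_of B) (U j)) \<and> (\<Union>j\<in>J. U j) = mspace B"

definition nerve2 :: "'j set \<Rightarrow> ('j \<Rightarrow> 'b set) \<Rightarrow> ('j \<times> 'j) set" where
  "nerve2 J U = {(j, k). j \<in> J \<and> k \<in> J \<and> U j \<inter> U k \<noteq> {}}"

definition nerve3 :: "'j set \<Rightarrow> ('j \<Rightarrow> 'b set) \<Rightarrow> ('j \<times> 'j \<times> 'j) set" where
  "nerve3 J U = {(j, k, l). j \<in> J \<and> k \<in> J \<and> l \<in> J \<and> U j \<inter> U k \<inter> U l \<noteq> {}}"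

definition preimage :: "'x metric \<Rightarrow> ('x \<Rightarrow> 'b) \<Rightarrow> 'b set \<Rightarrow> 'x set" where
  "preimage X \<pi> S = \<pi> -` S \<inter> mspace X"

section \<open>Approximate local trivializations and their witnesses\<close>

text \<open>Families and cochains are total functions. Only the values of \<open>f j\<close> on \<open>\<pi>\<^sup>-\<^sup>1(U j)\<close> for
  \<open>j \<in> J\<close>, and of \<open>\<Omega> j k\<close> for \<open>(j, k)\<close> in the nerve, are ever constrained or used.\<close>

definition circle_families ::
  "'x metric \<Rightarrow> ('x \<Rightarrow> 'b) \<Rightarrow> 'j set \<Rightarrow> ('j \<Rightarrow> 'b set) \<Rightarrow> ('j \<Rightarrow> 'x \<Rightarrow> complex) set" where
  "circle_families X \<pi> J U = {f. \<forall>j\<in>J. f j \<in> preimage X \<pi> (U j) \<rightarrow> S1}"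

definition approx_compatible ::
  "'x metric \<Rightarrow> ('x \<Rightarrow> 'b) \<Rightarrow> 'j set \<Rightarrow> ('j \<Rightarrow> 'b set) \<Rightarrow> real
     \<Rightarrow> ('j \<Rightarrow> 'j \<Rightarrow> real^2^2) \<Rightarrow> ('j \<Rightarrow> 'x \<Rightarrow> complex) \<Rightarrow> bool" where
  "approx_compatible X \<pi> J U \<epsilon> \<Omega> f \<longleftrightarrow>
     (\<forall>(j, k)\<in>nerve2 J U. \<Omega> j k \<in> O2 \<and>
        (\<forall>x\<in>preimage X \<pi> (U j \<inter> U k). norm (f j x - \<Omega> j k \<bullet>\<^sub>O f k x) < \<epsilon>))"

definition Gamma_eps_delta ::
  "'x metric \<Rightarrow> ('x \<Rightarrow> 'b) \<Rightarrow> 'j set \<Rightarrow> ('j \<Rightarrow> 'b set) \<Rightarrow> real \<Rightarrow> real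
     \<Rightarrow> ('j \<Rightarrow> 'x \<Rightarrow> complex) set" where
  "Gamma_eps_delta X \<pi> J U \<epsilon> \<delta> =
     {f \<in> circle_families X \<pi> J U.
        (\<exists>\<Omega>. approx_compatible X \<pi> J U \<epsilon> \<Omega> f) \<and>
        (\<forall>(j, k, l)\<in>nerve3 J U.
           hausdorff_dist (f l ` preimage X \<pi> (U j \<inter> U k \<inter> U l)) S1 < ennreal \<delta>)}"

definition witnesses_eps_delta ::
  "'x metric \<Rightarrow> ('x \<Rightarrow> 'b) \<Rightarrow> 'j set \<Rightarrow> ('j \<Rightarrow> 'b set) \<Rightarrow> real \<Rightarrow> real
     \<Rightarrow> ('j \<Rightarrow> 'j \<Rightarrow> real^2^2) \<Rightarrow> ('j \<Rightarrow> 'x \<Rightarrow> complex) \<Rightarrow> bool" where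
  "witnesses_eps_delta X \<pi> J U \<epsilon> \<delta> \<Omega> f \<longleftrightarrow>
     f \<in> Gamma_eps_delta X \<pi> J U \<epsilon> \<delta> \<and> approx_compatible X \<pi> J U \<epsilon> \<Omega> f"

definition admissible :: "real \<Rightarrow> (real \<times> real) set" where
  "admissible \<alpha> = {(\<epsilon>, \<delta>). 0 < \<epsilon> \<and> 0 \<le> \<delta> \<and> \<delta> < 1 \<and> \<epsilon> / (1 - \<delta>) < \<alpha>}"

definition Gamma_alpha ::
  "'x metric \<Rightarrow> ('x \<Rightarrow> 'b) \<Rightarrow> 'j set \<Rightarrow> ('j \<Rightarrow> 'b set) \<Rightarrow> real
     \<Rightarrow> ('j \<Rightarrow> 'x \<Rightarrow> complex) set" where
  "Gamma_alpha X \<pi> J U \<alpha> = (\<Union>(\<epsilon>, \<delta>)\<in>admissible \<alpha>. Gamma_eps_delta X \<pi> J U \<epsilon> \<delta>)"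

definition witnesses_alpha ::
  "'x metric \<Rightarrow> ('x \<Rightarrow> 'b) \<Rightarrow> 'j set \<Rightarrow> ('j \<Rightarrow> 'b set) \<Rightarrow> real
     \<Rightarrow> ('j \<Rightarrow> 'j \<Rightarrow> real^2^2) \<Rightarrow> ('j \<Rightarrow> 'x \<Rightarrow> complex) \<Rightarrow> bool" where
  "witnesses_alpha X \<pi> J U \<alpha> \<Omega> f \<longleftrightarrow>
     (\<exists>(\<epsilon>, \<delta>)\<in>admissible \<alpha>. witnesses_eps_delta X \<pi> J U \<epsilon> \<delta> \<Omega> f)"

section \<open>Discrete approximate cocycles\<close>

text \<open>A locally constant map is a continuous map into the discrete space \<^const>\<open>O2\<close>.
  The supremum is taken in \<^typ>\<open>ennreal\<close>, where it always exists and is 0 over an empty nerve.\<close>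

definition discrete_approx_cocycles ::
  "'b metric \<Rightarrow> 'j set \<Rightarrow> ('j \<Rightarrow> 'b set) \<Rightarrow> real \<Rightarrow> ('j \<Rightarrow> 'j \<Rightarrow> 'b \<Rightarrow> real^2^2) set" where
  "discrete_approx_cocycles B J U \<eta> =
     {\<Omega>. (\<forall>(j, k)\<in>nerve2 J U.
            continuous_map (subtopology (mtopology_of B) (U j \<inter> U k)) (discrete_topology O2) (\<Omega> j k)) \<and>
          (SUP (j, k, l)\<in>nerve3 J U. SUP b\<in>U j \<inter> U k \<inter> U l.
             ennreal (norm (\<Omega> j k b ** \<Omega> k l b - \<Omega> j l b))) < ennreal \<eta>}"

end

theory Submission
  imports Defs
begin

text \<open>Fix \<open>(j, k, l)\<close> in the nerve and put \<open>M = \<Omega> j k ** \<Omega> k l - \<Omega> j l\<close>. Comparing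
  \<open>f j\<close>, \<open>f k\<close> and \<open>f l\<close> pairwise gives \<open>\<bar>M w\<bar> < 3 \<epsilon>\<close> for every \<open>w\<close> in the image of \<open>f l\<close>.
  That image is \<open>\<delta>\<close>-dense in the circle, so the operator norm \<open>m\<close> of \<open>M\<close> satisfies
  \<open>m \<le> 3 \<epsilon> + m \<delta>\<close>. The Frobenius norm is at most \<open>sqrt 2\<close> times the operator norm.\<close>

text \<open>Splitting \<open>T v\<close> as \<open>T w + T (v - w)\<close> puts
  \<open>onorm T\<close> on both sides of its own estimate; since \<delta> < 1, the estimate can be
  solved for it.\<close>

lemma onorm_le_of_dense_in_sphere:
  fixes T :: "'a::real_normed_vector \<Rightarrow> 'b::real_normed_vector"
  assumes T: "bounded_linear T" and "\<delta> < 1" and "0 \<le> c"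
    and dense: "\<And>v. norm v = 1 \<Longrightarrow> \<exists>w. norm (v - w) \<le> \<delta> \<and> norm (T w) \<le> c"
  shows "onorm T \<le> c / (1 - \<delta>)"
proof (cases "\<exists>v::'a. v \<noteq> 0")
  \<comment> \<open>The zero space has no unit vectors, so \<open>dense\<close> is vacuous and the
    bound comes from \<open>T = 0\<close> and \<open>0 \<le> c\<close>.\<close>
  case False
  then have "T = (\<lambda>x. 0)"
    using bounded_linear.linear[OF T] linear_0 by (metis ext)
  then show ?thesis
    using assms by (simp add: onorm_zero)
next
  case True
  interpret T: bounded_linear T by (fact T)
  have unit: "norm (T v) \<le> c + onorm T * \<delta>" if v: "norm v = 1" for v
  proof -
    obtain w where w: "norm (v - w) \<le> \<delta>" "norm (T w) \<le> c"
      using dense[OF v] by blast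
    have "norm (T v) \<le> norm (T w) + norm (T (v - w))"
      using norm_triangle_ineq[of "T w" "T (v - w)"] by (simp add: T.diff)
    also have "\<dots> \<le> c + onorm T * \<delta>"
      using w onorm[OF T, of "v - w"] mult_left_mono[OF w(1) onorm_pos_le[OF T]]
      by linarith
    finally show ?thesis .
  qed
  have "norm (T x) \<le> (c + onorm T * \<delta>) * norm x" for x
  proof (cases "x = 0")
    case False
    then have "norm (T ((1 / norm x) *\<^sub>R x)) \<le> c + onorm T * \<delta>"
      by (intro unit) simp
    then show ?thesis
      using False by (simp add: T.scaleR field_simps)
  qed (simp add: T.zero)
  \<comment> \<open>\<open>onorm_bound\<close> asks for a nonnegative constant. The sign of \<delta>
    is not given, so it is read off from a unit vector.\<close>
  moreover have "0 \<le> c + onorm T * \<delta>"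
  proof -
    obtain v :: 'a where "v \<noteq> 0"
      using True by blast
    then have "norm (T (sgn v)) \<le> c + onorm T * \<delta>"
      by (intro unit) (simp add: norm_sgn)
    then show ?thesis
      using norm_ge_zero order_trans by blast
  qed
  ultimately have "onorm T \<le> c + onorm T * \<delta>"
    by (intro onorm_bound)
  then show ?thesis
    using \<open>\<delta> < 1\<close> by (simp add: field_simps)
qed

text \<open>Each column is the image of a unit basis vector, and the squared Frobenius norm is the
  sum of the squared norms of the \<open>CARD('n)\<close> columns. For 2 by 2 matrices this is the
  source of the factor \<open>sqrt 2\<close>.\<close>

lemma norm_matrix_le_onorm:
  fixes A :: "real^'n^'m"
  shows "norm A \<le> sqrt CARD('n) * onorm ((*v) A)"
proof -
  let ?m = "onorm ((*v) A)"
  have m: "0 \<le> ?m"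
    by (intro onorm_pos_le matrix_vector_mul_bounded_linear)
  have col: "norm (column j A) \<le> ?m" for j
    using onorm[OF matrix_vector_mul_bounded_linear, of A "axis j 1"]
    by (simp add: matrix_vector_mult_basis)
  have "(norm A)\<^sup>2 = (\<Sum>i\<in>UNIV. \<Sum>j\<in>UNIV. (A $ i $ j)\<^sup>2)"
    by (simp add: norm_eq_frobenius sum_nonneg)
  also have "\<dots> = (\<Sum>j\<in>UNIV. \<Sum>i\<in>UNIV. (A $ i $ j)\<^sup>2)"
    by (rule sum.swap)
  also have "\<dots> = (\<Sum>j\<in>UNIV. (norm (column j A))\<^sup>2)"
    by (simp add: norm_vec_def L2_set_def sum_nonneg column_def)
  also have "\<dots> \<le> (\<Sum>j\<in>(UNIV::'n set). ?m\<^sup>2)"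
    by (intro sum_mono power_mono col) simp
  also have "\<dots> = (sqrt CARD('n) * ?m)\<^sup>2"
    by (simp add: power_mult_distrib)
  finally show ?thesis
    using m by (simp add: power2_le_iff_abs_le)
qed

lemma complex_of_vec_inverse [simp]: "vec_of_complex (complex_of_vec v) = v"
  by (simp add: vec_of_complex_def complex_of_vec_def vec_eq_iff forall_2)

lemma vec_of_complex_diff: "vec_of_complex (z - w) = vec_of_complex z - vec_of_complex w"
  by (simp add: vec_of_complex_def vec_eq_iff forall_2)

lemma norm_vec_of_complex [simp]: "norm (vec_of_complex z) = norm z"
  by (simp add: vec_of_complex_def norm_vec_def L2_set_def sum_2 cmod_def)

lemma vec_of_complex_act [simp]: "vec_of_complex (A \<bullet>\<^sub>O z) = A *v vec_of_complex z"
  by (simp add: act_def)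

lemma norm_orthogonal_matrix_mult:
  fixes A :: "real^'n^'n"
  assumes "orthogonal_matrix A"
  shows "norm (A *v v) = norm v"
  using assms orthogonal_transformation_norm[of "(*v) A" v]
  by (simp add: orthogonal_transformation_matrix)

text \<open>The defect at \<open>c\<close> telescopes into the three comparison errors. One of them
  is multiplied by \<open>A\<close>, which preserves its length by orthogonality.\<close>

lemma norm_cocycle_defect_mult_less:
  fixes A B C :: "real^2^2"
  assumes "A \<in> O2"
    and "norm (a - A \<bullet>\<^sub>O b) < \<epsilon>" "norm (b - B \<bullet>\<^sub>O c) < \<epsilon>" "norm (a - C \<bullet>\<^sub>O c) < \<epsilon>"
  shows "norm ((A ** B - C) *v vec_of_complex c) < 3 * \<epsilon>"
proof -
  let ?a = "vec_of_complex a" and ?b = "vec_of_complex b" and ?c = "vec_of_complex c"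
  have diff: "norm (z - D \<bullet>\<^sub>O w) = norm (vec_of_complex z - D *v vec_of_complex w)" for z w D
    by (metis norm_vec_of_complex vec_of_complex_act vec_of_complex_diff)
  have "(A ** B - C) *v ?c = (?a - C *v ?c) - (?a - A *v ?b) - A *v (?b - B *v ?c)"
    by (simp add: matrix_vector_mult_diff_distrib matrix_vector_mult_diff_rdistrib
        matrix_vector_mul_assoc)
  also have "norm \<dots> \<le> norm (?a - C *v ?c) + norm (?a - A *v ?b) + norm (A *v (?b - B *v ?c))"
    by (meson add_right_mono norm_triangle_ineq4 order_trans)
  also have "norm (A *v (?b - B *v ?c)) = norm (?b - B *v ?c)"
    using \<open>A \<in> O2\<close> by (intro norm_orthogonal_matrix_mult) (simp add: O2_def)
  finally show ?thesis
    using assms(2-4) unfolding diff by linarith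
qed

text \<open>Only the second supremum in the maximum is used. An infimum over the empty set is
  infinite in \<open>ennreal\<close>, so the strict bound yields an actual point of
  \<open>A\<close>.\<close>

lemma hausdorff_dist_lessD:
  assumes "hausdorff_dist A B < ennreal \<delta>" and "b \<in> B"
  obtains a where "a \<in> A" and "dist a b < \<delta>"
proof -
  have "(INF a\<in>A. ennreal (dist a b)) \<le> (SUP b\<in>B. INF a\<in>A. ennreal (dist a b))"
    using \<open>b \<in> B\<close> by (rule SUP_upper)
  also have "\<dots> < ennreal \<delta>"
    using assms(1) by (simp add: hausdorff_dist_def)
  finally obtain a where "a \<in> A" "ennreal (dist a b) < ennreal \<delta>"
    by (auto simp: INF_less_iff)
  then show ?thesis
    by (intro that[of a]) (auto simp: ennreal_less_iff)
qed

lemma norm_cocycle_defect_le: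
  assumes wit: "witnesses_eps_delta X \<pi> J U \<epsilon> \<delta> \<Omega> f"
    and "0 < \<epsilon>" and "\<delta> < 1" and jkl: "(j, k, l) \<in> nerve3 J U"
  shows "norm (\<Omega> j k ** \<Omega> k l - \<Omega> j l) \<le> 3 * sqrt 2 * (\<epsilon> / (1 - \<delta>))"
proof -
  let ?M = "\<Omega> j k ** \<Omega> k l - \<Omega> j l"
  let ?P = "preimage X \<pi> (U j \<inter> U k \<inter> U l)"
  have haus: "hausdorff_dist (f l ` ?P) S1 < ennreal \<delta>"
    using wit jkl by (auto simp: witnesses_eps_delta_def Gamma_eps_delta_def)
  have comp: "approx_compatible X \<pi> J U \<epsilon> \<Omega> f"
    using wit by (simp add: witnesses_eps_delta_def)
  have nerve: "(j, k) \<in> nerve2 J U" "(k, l) \<in> nerve2 J U" "(j, l) \<in> nerve2 J U"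
    using jkl by (auto simp: nerve2_def nerve3_def)
  have small: "norm (?M *v vec_of_complex (f l x)) < 3 * \<epsilon>" if x: "x \<in> ?P" for x
  proof (rule norm_cocycle_defect_mult_less)
    have x': "x \<in> preimage X \<pi> (U j \<inter> U k)" "x \<in> preimage X \<pi> (U k \<inter> U l)"
      "x \<in> preimage X \<pi> (U j \<inter> U l)"
      using x by (auto simp: preimage_def)
    show "\<Omega> j k \<in> O2" "norm (f j x - \<Omega> j k \<bullet>\<^sub>O f k x) < \<epsilon>"
      "norm (f k x - \<Omega> k l \<bullet>\<^sub>O f l x) < \<epsilon>" "norm (f j x - \<Omega> j l \<bullet>\<^sub>O f l x) < \<epsilon>"
      using comp nerve x' unfolding approx_compatible_def by blast+
  qed
  have "onorm ((*v) ?M) \<le> 3 * \<epsilon> / (1 - \<delta>)"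
  proof (rule onorm_le_of_dense_in_sphere)
    fix v :: "real^2"
    assume "norm v = 1"
    then have "complex_of_vec v \<in> S1"
      by (metis complex_of_vec_inverse dist_0_norm mem_sphere norm_vec_of_complex)
    then obtain x where x: "x \<in> ?P" "dist (f l x) (complex_of_vec v) < \<delta>"
      using hausdorff_dist_lessD[OF haus] by (metis (no_types, lifting) imageE)
    \<comment> \<open>The approximant of \<open>v\<close> is \<open>vec_of_complex (f l x)\<close>:
      the identification of the plane with \<open>real^2\<close> is an isometry.\<close>
    have "norm (v - vec_of_complex (f l x)) = dist (f l x) (complex_of_vec v)"
      by (metis complex_of_vec_inverse dist_commute dist_norm norm_vec_of_complex
          vec_of_complex_diff)
    then show "\<exists>w. norm (v - w) \<le> \<delta> \<and> norm (?M *v w) \<le> 3 * \<epsilon>"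
      using x small[OF x(1)] by (metis less_imp_le)
  qed (use \<open>0 < \<epsilon>\<close> \<open>\<delta> < 1\<close> matrix_vector_mul_bounded_linear in auto)
  then have "sqrt 2 * onorm ((*v) ?M) \<le> sqrt 2 * (3 * \<epsilon> / (1 - \<delta>))"
    by (rule mult_left_mono) simp
  with norm_matrix_le_onorm[of ?M] show ?thesis
    by (simp add: mult.commute mult.left_commute)
qed

theorem proposition3p15:
  fixes X :: "'x metric" and B :: "'b metric" and \<pi> :: "'x \<Rightarrow> 'b"
    and J :: "'j set" and U :: "'j \<Rightarrow> 'b set" and \<alpha> :: real
    and f :: "'j \<Rightarrow> 'x \<Rightarrow> complex" and \<Omega> :: "'j \<Rightarrow> 'j \<Rightarrow> real^2^2"
  assumes "\<pi> \<in> mspace X \<rightarrow> mspace B"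
    and "open_cover B J U"
    and "\<alpha> > 0"
    and "f \<in> Gamma_alpha X \<pi> J U \<alpha>"
    and "witnesses_alpha X \<pi> J U \<alpha> \<Omega> f"
  shows "(\<lambda>j k b. \<Omega> j k) \<in> discrete_approx_cocycles B J U (3 * sqrt 2 * \<alpha>)"
proof -
  obtain \<epsilon> \<delta> where adm: "0 < \<epsilon>" "\<delta> < 1" "\<epsilon> / (1 - \<delta>) < \<alpha>"
    and wit: "witnesses_eps_delta X \<pi> J U \<epsilon> \<delta> \<Omega> f"
    using assms(5) by (auto simp: witnesses_alpha_def admissible_def)
  \<comment> \<open>A constant map is continuous into \<open>discrete_topology O2\<close> once its
    value lies in \<open>O2\<close>.\<close>
  have O2: "\<Omega> j k \<in> O2" if "(j, k) \<in> nerve2 J U" for j k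
    using wit that by (auto simp: witnesses_eps_delta_def approx_compatible_def)
  have "(SUP (j, k, l)\<in>nerve3 J U. SUP b\<in>U j \<inter> U k \<inter> U l.
      ennreal (norm (\<Omega> j k ** \<Omega> k l - \<Omega> j l))) \<le> ennreal (3 * sqrt 2 * (\<epsilon> / (1 - \<delta>)))"
    using norm_cocycle_defect_le[OF wit adm(1,2)]
    by (auto intro!: SUP_least ennreal_leI)
  \<comment> \<open>A supremum preserves only non-strict bounds. Strictness comes from the gap
    between \<open>\<epsilon> / (1 - \<delta>)\<close> and \<alpha>, which is the same for all
    triples of the nerve.\<close>
  also have "\<dots> < ennreal (3 * sqrt 2 * \<alpha>)"
    using adm by (intro ennreal_lessI mult_strict_left_mono) (auto simp: \<open>\<alpha> > 0\<close>)
  finally show ?thesis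
    using O2 by (auto simp: discrete_approx_cocycles_def)
qed

end
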